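(* (Label propagation and denoising.) Suppose the label noise is generated by the noise transition matrix $T=\begin{bmatrix}1-e & e\\ e & 1-e\end{bmatrix}$ and the label propagation follows $$\hat Y_i=(1-\alpha)\tilde Y_i+\frac{\alpha}{d}\sum_{v_j\in\mathcal{N}_i}\tilde Y_j .$$ For a specific node $i$, assume further that the node has $d$ neighbors, and that its neighbor nodes have probability $p$ of having the same true label as node $i$, i.e. $\mathbb{P}[Y_i=Y_j]=p$. Then after one round of label propagation, the gap between the propagated label and the ground-truth label is $$\mathbb{E}(Y-\hat Y)^2=\mathbb{P}(Y=0)\,\mathbb{E}(\hat Y\mid Y=0)^2+\mathbb{P}(Y=1)\left(\mathbb{E}(\hat Y\mid Y=1)-1\right)^2+\mathrm{Var}(\hat Y),$$ where $$\mathbb{E}(\hat Y\mid Y=0)=(1-\alpha)e+\alpha[pe+(1-p)(1-e)],$$ $$\mathbb{E}(\hat Y\mid Y=1)=(1-\alpha)(1-e)+\alpha[p(1-e)+(1-p)e],$$ $$\mathrm{Var}(\hat Y)=(1-\alpha)^2e(1-e)+\frac{\alpha^2}{d}\,[pe+(1-p)(1-e)]\,[1-pe-(1-p)(1-e)].$$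
   Context: Binary node classification on a graph, with labels in $\{0,1\}$. For a node $v_i$ (also written node $i$), $Y_i$ is its true (clean) label, $\tilde Y_i$ its noisy label, $\mathcal{N}_i$ its set of neighbors, and $\hat Y_i$ its propagated label, which is a random variable; $Y$ and $\hat Y$ without index stand for $Y_i$ and $\hat Y_i$ of the specific node $i$ considered. The clean labels are corrupted by a noise transition matrix $T$, whose entry $T_{kl}=\mathbb{P}(\tilde Y=C_l\mid Y=C_k)$ is the probability that label $C_k$ is corrupted into label $C_l$; so with the matrix above, $e$ is the probability that a label is flipped. The parameter $\alpha$ is the weight given to the neighbors' labels in the propagation. $\mathbb{E}(Y-\hat Y)^2$ means the expectation of $(Y-\hat Y)^2$, and $\mathbb{E}(\hat Y\mid Y=0)^2$ means the square of the conditional expectation $\mathbb{E}(\hat Y\mid Y=0)$.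
   Formalization: Var(Ŷ) is read as the variance given Y, E[Var(Ŷ|Y)]; the agreement probability p is assumed conditionally on each value of Y_i; the neighbors' true labels are assumed independent given Y_i, and noise independent across nodes given all true labels. As printed, the formulas fail. *)

theory Defs
  imports "HOL-Probability.Probability" "Graph_Theory.Pair_Digraph"
begin

definition neighbors :: "'v pair_pre_digraph \<Rightarrow> 'v \<Rightarrow> 'v set" where
  "neighbors G i = {j. (i, j) \<in> parcs G}"

(* Labels are natural numbers in {0, 1}; measurability into the two-point space
   also forces the values to lie in {0, 1}. *)
abbreviation label_space :: "nat measure" where
  "label_space \<equiv> count_space {0, 1}"

(* The measure M conditioned on the event Q; meaningful if Q has positive probability,
   and the zero measure otherwise. *)
definition cond_measure :: "'a measure \<Rightarrow> ('a \<Rightarrow> bool) \<Rightarrow> 'a measure" where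
  "cond_measure M Q = uniform_measure M {\<omega> \<in> space M. Q \<omega>}"

definition cond_expectation :: "'a measure \<Rightarrow> ('a \<Rightarrow> real) \<Rightarrow> ('a \<Rightarrow> bool) \<Rightarrow> real" where
  "cond_expectation M X Q = (LINT \<omega>|cond_measure M Q. X \<omega>)"

definition cond_variance :: "'a measure \<Rightarrow> ('a \<Rightarrow> real) \<Rightarrow> ('a \<Rightarrow> bool) \<Rightarrow> real" where
  "cond_variance M X Q = (LINT \<omega>|cond_measure M Q. (X \<omega> - cond_expectation M X Q)\<^sup>2)"

(* E[Var(X | Z)] for a binary label Z: the variance of X around its class-conditional mean.
   This, and not the unconditional variance, is the variance term in the bias-variance
   decomposition of E(Z - X)^2 whose bias terms use the class-conditional means E(X | Z = k);
   the unconditional variance also contains the spread between these two means. *)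
definition mean_cond_variance :: "'a measure \<Rightarrow> ('a \<Rightarrow> real) \<Rightarrow> ('a \<Rightarrow> nat) \<Rightarrow> real" where
  "mean_cond_variance M X Z =
     (\<Sum>k\<in>{0, 1}. \<P>(\<omega> in M. Z \<omega> = k) * cond_variance M X (\<lambda>\<omega>. Z \<omega> = k))"

(* Matrices are lists of rows, so that the (k, l) entry, with labels as indices, is T ! k ! l. *)
definition flip_matrix :: "real \<Rightarrow> real list list" where
  "flip_matrix e = [[1 - e, e],
                    [e, 1 - e]]"

(* Given the clean labels Y of all nodes in V, the noisy labels Yt are drawn independently,
   the one of node v according to row Y v of T.  In particular
   P(Yt v = l | Y v = k) = T ! k ! l. *)
definition noise_generated_by ::
  "real list list \<Rightarrow> 'a measure \<Rightarrow> 'v set \<Rightarrow> ('v \<Rightarrow> 'a \<Rightarrow> nat) \<Rightarrow> ('v \<Rightarrow> 'a \<Rightarrow> nat) \<Rightarrow> bool" where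
  "noise_generated_by T M V Y Yt \<longleftrightarrow>
     (\<forall>y. \<P>(\<omega> in M. \<forall>v\<in>V. Y v \<omega> = y v) > 0 \<longrightarrow>
        prob_space.indep_vars (cond_measure M (\<lambda>\<omega>. \<forall>v\<in>V. Y v \<omega> = y v)) (\<lambda>_. label_space) Yt V \<and>
        (\<forall>v\<in>V. \<forall>l\<in>{0, 1}.
           \<P>(\<omega> in M. Yt v \<omega> = l \<bar> \<forall>v\<in>V. Y v \<omega> = y v) = T ! y v ! l))"

definition propagate ::
  "'v pair_pre_digraph \<Rightarrow> real \<Rightarrow> nat \<Rightarrow> ('v \<Rightarrow> 'a \<Rightarrow> nat) \<Rightarrow> 'v \<Rightarrow> 'a \<Rightarrow> real" where
  "propagate G \<alpha> d Yt i \<omega> =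
     (1 - \<alpha>) * real (Yt i \<omega>) + \<alpha> / real d * (\<Sum>j\<in>neighbors G i. real (Yt j \<omega>))"

end

theory Submission
  imports Defs
begin

(* Conditionally on all clean labels, the noisy labels are independent with means r (Y v), where
   r y = e + (1 - 2 * e) * y.  Averaging over the clean labels compatible with Y i = k therefore turns
   the first and the mixed second moments of the noisy labels into those of the r (Y v).  Since the
   clean labels of the neighbours are independent given Y i = k, the noisy labels of i and of its
   neighbours are pairwise uncorrelated, and both class-conditional moments of their weighted sum
   can be read off. *)

text \<open>The obstacle is a mismatch of conditioning: \<open>noise_generated_by\<close> gives
  independence only once the complete clean labelling is fixed, while the claim conditions on
  \<open>Y i = k\<close> alone, where the neighbours' clean labels are still random. Independence
  does not survive averaging over labellings, but equalities of conditional expectations do, so only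
  expectations of single noisy labels and of products of two are tracked; these already determine
  the mean and the variance of a weighted sum. The graph is finite, so the labellings form a finite
  partition and the averaging is a finite sum, in which labellings of probability 0 carry weight 0.
  The values \<open>r 0 = e\<close> and \<open>r 1 = 1 - e\<close> are the two entries of the flip
  matrix in the column of label 1. Because \<open>r\<close> is affine, it commutes with expectations
  and preserves uncorrelatedness. Passing from class 0 to class 1 replaces each noisy mean x by 1 -
  x and leaves x * (1 - x) unchanged; this is why one variance formula serves both classes.\<close>

section \<open>Random variables with values 0 and 1, and their weighted sums\<close>

lemma label_valued:
  assumes "X \<in> M \<rightarrow>\<^sub>M label_space" "\<omega> \<in> space M"
  shows "X \<omega> = 0 \<or> X \<omega> = 1"
  using measurable_space[OF assms] by auto

lemma borel_measurable_label:
  assumes "X \<in> M \<rightarrow>\<^sub>M label_space"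
  shows "(\<lambda>\<omega>. real (X \<omega>)) \<in> borel_measurable M"
  using measurable_compose[OF assms, of real borel] by simp

lemma pred_label_eq:
  assumes "X \<in> M \<rightarrow>\<^sub>M label_space"
  shows "Measurable.pred M (\<lambda>\<omega>. X \<omega> = k)"
  using measurable_compose[OF assms, of "\<lambda>x. x = k" "count_space UNIV"] by simp

context prob_space
begin

lemma integrable_label:
  assumes "X \<in> M \<rightarrow>\<^sub>M label_space"
  shows "integrable M (\<lambda>\<omega>. real (X \<omega>))"
  by (rule integrable_const_bound[where B=1])
     (auto intro!: AE_I2 borel_measurable_label[OF assms] dest: label_valued[OF assms])

lemma integrable_label_mult:
  assumes "X \<in> M \<rightarrow>\<^sub>M label_space" "Z \<in> M \<rightarrow>\<^sub>M label_space"
  shows "integrable M (\<lambda>\<omega>. real (X \<omega>) * real (Z \<omega>))"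
  by (rule integrable_const_bound[where B=1])
     (use label_valued[OF assms(1)] label_valued[OF assms(2)] in
       \<open>force intro!: AE_I2 borel_measurable_times borel_measurable_label assms\<close>)+

lemma expectation_label:
  assumes "X \<in> M \<rightarrow>\<^sub>M label_space"
  shows "expectation (\<lambda>\<omega>. real (X \<omega>)) = \<P>(\<omega> in M. X \<omega> = 1)"
proof -
  have [measurable]: "Measurable.pred M (\<lambda>\<omega>. X \<omega> = 1)"
    by (rule pred_label_eq[OF assms])
  have "expectation (\<lambda>\<omega>. real (X \<omega>)) = expectation (indicator {\<omega> \<in> space M. X \<omega> = 1})"
    using label_valued[OF assms] by (intro Bochner_Integration.integral_cong) (auto simp: indicator_def)
  also have "\<dots> = \<P>(\<omega> in M. X \<omega> = 1)"
    by (subst Bochner_Integration.integral_indicator) (auto intro: arg_cong[where f=prob])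
  finally show ?thesis .
qed

lemma indep_vars_label_mult:
  assumes "indep_vars (\<lambda>_. label_space) X I" "u \<in> I" "v \<in> I" "u \<noteq> v"
  shows "expectation (\<lambda>\<omega>. real (X u \<omega>) * real (X v \<omega>)) =
         expectation (\<lambda>\<omega>. real (X u \<omega>)) * expectation (\<lambda>\<omega>. real (X v \<omega>))"
proof -
  have meas: "\<And>w. w \<in> {u, v} \<Longrightarrow> X w \<in> M \<rightarrow>\<^sub>M label_space"
    using assms unfolding indep_vars_def by auto
  have "indep_vars (\<lambda>_. borel) (\<lambda>w \<omega>. real (X w \<omega>)) {u, v}"
    using indep_vars_compose2[OF indep_vars_subset[OF assms(1), of "{u, v}"], of "\<lambda>_. real" "\<lambda>_. borel"]
      assms by auto
  from indep_vars_lebesgue_integral[OF _ this integrable_label[OF meas]] show ?thesis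
    using assms(4) by simp
qed

text \<open>A 0/1 label equals its own square, so its second moment is its mean m and its variance
  is m * (1 - m); the off-diagonal covariances vanish. Pairwise uncorrelatedness is the hypothesis
  because that is what can be established given only the class of the node.\<close>

lemma weighted_label_sum:
  fixes c :: "'i \<Rightarrow> real"
  assumes fin: "finite I"
    and X: "\<And>v. v \<in> I \<Longrightarrow> X v \<in> M \<rightarrow>\<^sub>M label_space"
    and uncor: "\<And>u v. u \<in> I \<Longrightarrow> v \<in> I \<Longrightarrow> u \<noteq> v \<Longrightarrow>
      expectation (\<lambda>\<omega>. real (X u \<omega>) * real (X v \<omega>)) =
      expectation (\<lambda>\<omega>. real (X u \<omega>)) * expectation (\<lambda>\<omega>. real (X v \<omega>))"
  defines "m \<equiv> \<lambda>v. expectation (\<lambda>\<omega>. real (X v \<omega>))"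
  shows expectation_weighted_label_sum:
      "expectation (\<lambda>\<omega>. \<Sum>v\<in>I. c v * real (X v \<omega>)) = (\<Sum>v\<in>I. c v * m v)"
    and variance_weighted_label_sum:
      "variance (\<lambda>\<omega>. \<Sum>v\<in>I. c v * real (X v \<omega>)) = (\<Sum>v\<in>I. (c v)\<^sup>2 * (m v * (1 - m v)))"
proof -
  note int = integrable_label[OF X] and int2 = integrable_label_mult[OF X X]
  show mean: "expectation (\<lambda>\<omega>. \<Sum>v\<in>I. c v * real (X v \<omega>)) = (\<Sum>v\<in>I. c v * m v)"
    unfolding m_def by (simp add: int)
  have square: "expectation (\<lambda>\<omega>. real (X v \<omega>) * real (X v \<omega>)) = m v" if "v \<in> I" for v
    unfolding m_def using label_valued[OF X[OF that]]
    by (intro Bochner_Integration.integral_cong) auto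
  have int_cov: "integrable M (\<lambda>\<omega>. (real (X u \<omega>) - m u) * (real (X v \<omega>) - m v))"
    if "u \<in> I" "v \<in> I" for u v
    using int int2 that by (simp add: algebra_simps)
  have cov: "expectation (\<lambda>\<omega>. (real (X u \<omega>) - m u) * (real (X v \<omega>) - m v))
      = (if u = v then m u * (1 - m u) else 0)" if uv: "u \<in> I" "v \<in> I" for u v
  proof -
    have "expectation (\<lambda>\<omega>. (real (X u \<omega>) - m u) * (real (X v \<omega>) - m v))
        = expectation (\<lambda>\<omega>. real (X u \<omega>) * real (X v \<omega>) - m v * real (X u \<omega>)
            - m u * real (X v \<omega>) + m u * m v)"
      by (intro Bochner_Integration.integral_cong) (auto simp: algebra_simps)
    also have "\<dots> = expectation (\<lambda>\<omega>. real (X u \<omega>) * real (X v \<omega>)) - m v * m u - m u * m v + m u * m v"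
      using int int2 uv by (simp add: m_def prob_space)
    finally show ?thesis
      using square uncor uv by (cases "u = v") (auto simp: m_def algebra_simps)
  qed
  have "variance (\<lambda>\<omega>. \<Sum>v\<in>I. c v * real (X v \<omega>))
      = expectation (\<lambda>\<omega>. (\<Sum>v\<in>I. c v * (real (X v \<omega>) - m v))\<^sup>2)"
    unfolding mean by (simp add: right_diff_distrib sum_subtractf)
  also have "\<dots> = expectation (\<lambda>\<omega>. \<Sum>u\<in>I. \<Sum>v\<in>I.
      c u * c v * ((real (X u \<omega>) - m u) * (real (X v \<omega>) - m v)))"
    by (simp add: power2_eq_square sum_product mult_ac)
  also have "\<dots> = (\<Sum>u\<in>I. \<Sum>v\<in>I. c u * c v * (if u = v then m u * (1 - m u) else 0))"
    by (simp add: int_cov cov)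
  also have "\<dots> = (\<Sum>u\<in>I. \<Sum>v\<in>I. if u = v then (c u)\<^sup>2 * (m u * (1 - m u)) else 0)"
    by (intro sum.cong refl) (simp add: power2_eq_square)
  also have "\<dots> = (\<Sum>v\<in>I. (c v)\<^sup>2 * (m v * (1 - m v)))"
    using fin by simp
  finally show "variance (\<lambda>\<omega>. \<Sum>v\<in>I. c v * real (X v \<omega>)) = (\<Sum>v\<in>I. (c v)\<^sup>2 * (m v * (1 - m v)))" .
qed

section \<open>Conditioning on an event and on the fibres of a finite-valued map\<close>

lemma prob_space_cond_measure:
  assumes "\<P>(\<omega> in M. Q \<omega>) > 0"
  shows "prob_space (cond_measure M Q)"
  unfolding cond_measure_def using assms
  by (intro prob_space_uniform_measure) (auto simp: emeasure_eq_measure)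

lemma prob_cond_measure:
  assumes "Measurable.pred M P" "Measurable.pred M Q"
  shows "\<P>(\<omega> in cond_measure M Q. P \<omega>) = \<P>(\<omega> in M. P \<omega> \<bar> Q \<omega>)"
  using measure_uniform_measure_eq_cond_prob[OF assms] by (simp add: cond_measure_def)

lemma AE_cond_measure:
  assumes [measurable]: "Measurable.pred M Q"
  shows "AE \<omega> in cond_measure M Q. Q \<omega>"
  unfolding cond_measure_def by (rule AE_uniform_measureI) auto

lemma measurable_cond_measure [simp]: "measurable (cond_measure M Q) N = measurable M N"
  by (rule measurable_cong_sets) (simp_all add: cond_measure_def)

lemma space_cond_measure [simp]: "space (cond_measure M Q) = space M"
  by (simp add: cond_measure_def)

text \<open>The multiplied form also covers events of probability 0, where both sides are 0. Sums
  over classes or labellings can thus be formed without separating the null ones.\<close>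

lemma prob_times_cond_expectation:
  assumes [measurable]: "Measurable.pred M Q" "f \<in> borel_measurable M"
  shows "\<P>(\<omega> in M. Q \<omega>) * cond_expectation M f Q
    = expectation (\<lambda>\<omega>. indicator {\<omega> \<in> space M. Q \<omega>} \<omega> * f \<omega>)"
proof (cases "\<P>(\<omega> in M. Q \<omega>) = 0")
  case True
  then have "AE \<omega> in M. \<not> Q \<omega>" by (simp add: prob_eq_0)
  then have "expectation (\<lambda>\<omega>. indicator {\<omega> \<in> space M. Q \<omega>} \<omega> * f \<omega>) = expectation (\<lambda>_. 0)"
    by (intro integral_cong_AE) auto
  with True show ?thesis by simp
next
  case False
  define q where "q = \<P>(\<omega> in M. Q \<omega>)"
  have q: "q > 0" using False measure_nonneg[of M] by (simp add: q_def less_le)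
  \<comment> \<open>Normalising the indicator by the real number \<open>q\<close> turns the uniform
    measure into a real density, so the conditional integral becomes an integral over
    \<open>M\<close>.\<close>
  have "cond_measure M Q = density M (\<lambda>\<omega>. ennreal (indicator {\<omega> \<in> space M. Q \<omega>} \<omega> / q))"
    unfolding cond_measure_def uniform_measure_def using q
    by (intro density_cong)
       (auto simp: emeasure_eq_measure q_def[symmetric] indicator_def divide_ennreal[of 1, simplified])
  then have "cond_expectation M f Q = expectation (\<lambda>\<omega>. (indicator {\<omega> \<in> space M. Q \<omega>} \<omega> / q) *\<^sub>R f \<omega>)"
    unfolding cond_expectation_def using q by (simp add: integral_density)
  also have "\<dots> = expectation (\<lambda>\<omega>. indicator {\<omega> \<in> space M. Q \<omega>} \<omega> * f \<omega>) / q"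
    by simp
  finally show ?thesis using q by (simp add: q_def)
qed

lemma integrable_indicator_mult:
  fixes f :: "'a \<Rightarrow> real"
  assumes "Measurable.pred M Q" "integrable M f"
  shows "integrable M (\<lambda>\<omega>. indicator {\<omega> \<in> space M. Q \<omega>} \<omega> * f \<omega>)"
  using assms integrable_mult_indicator[of "{\<omega> \<in> space M. Q \<omega>}" M f] by simp

lemma expectation_eq_sum_indicator:
  fixes f :: "'a \<Rightarrow> real"
  assumes "finite S" "g \<in> space M \<rightarrow> S"
    and [measurable]: "\<And>s. s \<in> S \<Longrightarrow> Measurable.pred M (\<lambda>\<omega>. g \<omega> = s)" "integrable M f"
  shows "expectation f = (\<Sum>s\<in>S. expectation (\<lambda>\<omega>. indicator {\<omega> \<in> space M. g \<omega> = s} \<omega> * f \<omega>))"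
proof -
  have "expectation f = expectation (\<lambda>\<omega>. \<Sum>s\<in>S. indicator {\<omega> \<in> space M. g \<omega> = s} \<omega> * f \<omega>)"
  proof (intro Bochner_Integration.integral_cong refl)
    fix \<omega> assume "\<omega> \<in> space M"
    then have "(\<Sum>s\<in>S. indicator {\<omega> \<in> space M. g \<omega> = s} \<omega> * f \<omega>) = (\<Sum>s\<in>S. if g \<omega> = s then f \<omega> else 0)"
      by (intro sum.cong) auto
    with \<open>\<omega> \<in> space M\<close> show "f \<omega> = (\<Sum>s\<in>S. indicator {\<omega> \<in> space M. g \<omega> = s} \<omega> * f \<omega>)"
      using assms(1,2) by (auto simp: Pi_iff)
  qed
  also have "\<dots> = (\<Sum>s\<in>S. expectation (\<lambda>\<omega>. indicator {\<omega> \<in> space M. g \<omega> = s} \<omega> * f \<omega>))"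
    by (intro Bochner_Integration.integral_sum integrable_indicator_mult) (use assms(3,4) in auto)
  finally show ?thesis .
qed

lemma expectation_eq_sum_cond_expectation:
  assumes "finite S" "g \<in> space M \<rightarrow> S"
    and "\<And>s. s \<in> S \<Longrightarrow> Measurable.pred M (\<lambda>\<omega>. g \<omega> = s)" "integrable M f"
  shows "expectation f = (\<Sum>s\<in>S. \<P>(\<omega> in M. g \<omega> = s) * cond_expectation M f (\<lambda>\<omega>. g \<omega> = s))"
proof -
  have "\<P>(\<omega> in M. g \<omega> = s) * cond_expectation M f (\<lambda>\<omega>. g \<omega> = s)
      = expectation (\<lambda>\<omega>. indicator {\<omega> \<in> space M. g \<omega> = s} \<omega> * f \<omega>)" if "s \<in> S" for s
    using assms(3)[OF that] assms(4) by (intro prob_times_cond_expectation) auto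
  then show ?thesis
    using expectation_eq_sum_indicator[OF assms] by simp
qed

text \<open>A finite tower property: the event \<open>h (g \<omega>)\<close> is a union of fibres of
  \<open>g\<close>, and the expectation conditioned on it is the weighted average of those
  conditioned on the fibres. It transfers identities known for each complete labelling to the
  coarser event that only fixes the label of one node.\<close>

lemma cond_expectation_eqI_finer:
  assumes S: "finite S" "g \<in> space M \<rightarrow> S" "\<And>s. s \<in> S \<Longrightarrow> Measurable.pred M (\<lambda>\<omega>. g \<omega> = s)"
    and f: "integrable M f" and f': "integrable M f'"
    and eq: "\<And>s. s \<in> S \<Longrightarrow> \<P>(\<omega> in M. g \<omega> = s) > 0 \<Longrightarrow>
      cond_expectation M f (\<lambda>\<omega>. g \<omega> = s) = cond_expectation M f' (\<lambda>\<omega>. g \<omega> = s)"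
    and Q: "Measurable.pred M (\<lambda>\<omega>. h (g \<omega>))" "\<P>(\<omega> in M. h (g \<omega>)) > 0"
  shows "cond_expectation M f (\<lambda>\<omega>. h (g \<omega>)) = cond_expectation M f' (\<lambda>\<omega>. h (g \<omega>))"
proof -
  have expand: "\<P>(\<omega> in M. h (g \<omega>)) * cond_expectation M \<phi> (\<lambda>\<omega>. h (g \<omega>))
      = (\<Sum>s\<in>S. of_bool (h s) * (\<P>(\<omega> in M. g \<omega> = s) * cond_expectation M \<phi> (\<lambda>\<omega>. g \<omega> = s)))"
    if \<phi>: "integrable M \<phi>" for \<phi>
  proof -
    have int: "integrable M (\<lambda>\<omega>. indicator {\<omega> \<in> space M. h (g \<omega>)} \<omega> * \<phi> \<omega>)"
      by (rule integrable_indicator_mult[OF Q(1) \<phi>])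
    have "\<P>(\<omega> in M. h (g \<omega>)) * cond_expectation M \<phi> (\<lambda>\<omega>. h (g \<omega>))
        = expectation (\<lambda>\<omega>. indicator {\<omega> \<in> space M. h (g \<omega>)} \<omega> * \<phi> \<omega>)"
      using \<phi> Q(1) by (intro prob_times_cond_expectation) auto
    also have "\<dots> = (\<Sum>s\<in>S. expectation (\<lambda>\<omega>. indicator {\<omega> \<in> space M. g \<omega> = s} \<omega> *
        (indicator {\<omega> \<in> space M. h (g \<omega>)} \<omega> * \<phi> \<omega>)))"
      by (rule expectation_eq_sum_indicator[OF S int])
    \<comment> \<open>On the fibre \<open>g \<omega> = s\<close> the indicator of the coarse event
      is the constant \<open>of_bool (h s)\<close>.\<close>
    also have "\<dots> = (\<Sum>s\<in>S. expectation (\<lambda>\<omega>. of_bool (h s) *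
        (indicator {\<omega> \<in> space M. g \<omega> = s} \<omega> * \<phi> \<omega>)))"
      by (intro sum.cong Bochner_Integration.integral_cong) (auto simp: indicator_def)
    also have "\<dots> = (\<Sum>s\<in>S. of_bool (h s) * (\<P>(\<omega> in M. g \<omega> = s) * cond_expectation M \<phi> (\<lambda>\<omega>. g \<omega> = s)))"
      using \<phi> S(3) by (intro sum.cong) (simp_all add: prob_times_cond_expectation)
    finally show ?thesis .
  qed
  have "\<P>(\<omega> in M. h (g \<omega>)) * cond_expectation M f (\<lambda>\<omega>. h (g \<omega>))
      = \<P>(\<omega> in M. h (g \<omega>)) * cond_expectation M f' (\<lambda>\<omega>. h (g \<omega>))"
    unfolding expand[OF f] expand[OF f']
  proof (intro sum.cong refl)
    \<comment> \<open>The premise \<open>eq\<close> speaks only of fibres of positive probability;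
      on the others both summands have the factor 0.\<close>
    fix s assume "s \<in> S"
    then show "of_bool (h s) * (\<P>(\<omega> in M. g \<omega> = s) * cond_expectation M f (\<lambda>\<omega>. g \<omega> = s))
        = of_bool (h s) * (\<P>(\<omega> in M. g \<omega> = s) * cond_expectation M f' (\<lambda>\<omega>. g \<omega> = s))"
      using eq[of s] by (cases "\<P>(\<omega> in M. g \<omega> = s) = 0") (auto simp: zero_less_measure_iff)
  qed
  with Q(2) show ?thesis by simp
qed

end

section \<open>From noisy to clean labels, given the class of a node\<close>

text \<open>Given a full labelling, \<open>r (Y u)\<close> is the probability that
  \<open>Yt u\<close> is 1, and distinct noisy labels are independent. The right-hand sides keep
  \<open>Y u\<close> random because the condition fixes only the label of \<open>i\<close>. The
  restriction to distinct nodes is essential: for \<open>u = v\<close> the left-hand product is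
  \<open>Yt u\<close> itself, not the square of its conditional mean.\<close>

lemma (in prob_space) noisy_label_moments:
  assumes fin: "finite V"
    and Y: "\<And>v. v \<in> V \<Longrightarrow> Y v \<in> M \<rightarrow>\<^sub>M label_space"
    and Yt: "\<And>v. v \<in> V \<Longrightarrow> Yt v \<in> M \<rightarrow>\<^sub>M label_space"
    and noise: "noise_generated_by (flip_matrix e) M V Y Yt"
    and i: "i \<in> V" and pos: "\<P>(\<omega> in M. Y i \<omega> = k) > 0"
    and u: "u \<in> V"
  defines "r \<equiv> \<lambda>y. e + (1 - 2 * e) * real y"
  shows cond_expectation_noisy_label:
      "cond_expectation M (\<lambda>\<omega>. real (Yt u \<omega>)) (\<lambda>\<omega>. Y i \<omega> = k)
        = cond_expectation M (\<lambda>\<omega>. r (Y u \<omega>)) (\<lambda>\<omega>. Y i \<omega> = k)" (is ?mean)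
    and cond_expectation_noisy_label_mult:
      "v \<in> V \<Longrightarrow> u \<noteq> v \<Longrightarrow>
        cond_expectation M (\<lambda>\<omega>. real (Yt u \<omega>) * real (Yt v \<omega>)) (\<lambda>\<omega>. Y i \<omega> = k)
        = cond_expectation M (\<lambda>\<omega>. r (Y u \<omega>) * r (Y v \<omega>)) (\<lambda>\<omega>. Y i \<omega> = k)" (is "_ \<Longrightarrow> _ \<Longrightarrow> ?mult v")
proof -
  define S where "S = (\<Pi>\<^sub>E v\<in>V. {0, 1::nat})"
  \<comment> \<open>Restricting to \<open>V\<close> makes the labellings extensional functions: they
    form a finite set, and \<open>g \<omega> = s\<close> means agreement exactly on
    \<open>V\<close>.\<close>
  define g where "g = (\<lambda>\<omega>. restrict (\<lambda>v. Y v \<omega>) V)"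
  have g_eq: "g \<omega> = s \<longleftrightarrow> (\<forall>v\<in>V. Y v \<omega> = s v)" if "s \<in> S" for s \<omega>
    using that by (auto simp: g_def S_def fun_eq_iff PiE_def extensional_def)
  have finS: "finite S" unfolding S_def by (intro finite_PiE fin) auto
  have gS: "g \<in> space M \<rightarrow> S" using label_valued[OF Y] by (auto simp: g_def S_def)
  have pred_Y: "Measurable.pred M (\<lambda>\<omega>. Y v \<omega> = l)" if "v \<in> V" for v l
    by (rule pred_label_eq[OF Y[OF that]])
  have pred_g: "Measurable.pred M (\<lambda>\<omega>. g \<omega> = s)" if "s \<in> S" for s
    unfolding g_eq[OF that] using fin
    by (intro pred_intros_finite) (auto intro: pred_Y)
  \<comment> \<open>As \<open>i\<close> lies in \<open>V\<close>, the class of \<open>i\<close> is a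
    function of the labelling, which gives the conditioning event the shape of a union of
    fibres.\<close>
  have in_class: "(\<lambda>\<omega>. Y i \<omega> = k) = (\<lambda>\<omega>. g \<omega> i = k)"
    using i by (simp add: g_def)
  have pred_class: "Measurable.pred M (\<lambda>\<omega>. g \<omega> i = k)"
    using pred_Y[OF i, of k] by (simp add: in_class)
  have pos_class: "\<P>(\<omega> in M. g \<omega> i = k) > 0"
    using pos i by (simp add: g_def)
  have int_r: "integrable M (\<lambda>\<omega>. r (Y v \<omega>))" if "v \<in> V" for v
    unfolding r_def using integrable_label[OF Y[OF that]] by auto
  have int_r2: "integrable M (\<lambda>\<omega>. r (Y v \<omega>) * r (Y w \<omega>))" if "v \<in> V" "w \<in> V" for v w
  proof -
    have "(\<lambda>\<omega>. r (Y v \<omega>) * r (Y w \<omega>)) = (\<lambda>\<omega>. e * e + e * (1 - 2 * e) * real (Y v \<omega>)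
        + e * (1 - 2 * e) * real (Y w \<omega>) + (1 - 2 * e)\<^sup>2 * (real (Y v \<omega>) * real (Y w \<omega>)))"
      by (simp add: r_def algebra_simps power2_eq_square)
    then show ?thesis
      using integrable_label[OF Y] integrable_label_mult[OF Y Y] that by simp
  qed
  \<comment> \<open>On one fibre all randomness of the clean labels is gone: \<open>Y v\<close> is
    almost surely the number \<open>s v\<close>, and the mean of \<open>Yt v\<close> is read off
    column 1 of row \<open>s v\<close> of the flip matrix.\<close>
  have given: "prob_space (cond_measure M (\<lambda>\<omega>. g \<omega> = s))
      \<and> prob_space.indep_vars (cond_measure M (\<lambda>\<omega>. g \<omega> = s)) (\<lambda>_. label_space) Yt V
      \<and> (\<forall>v\<in>V. cond_expectation M (\<lambda>\<omega>. real (Yt v \<omega>)) (\<lambda>\<omega>. g \<omega> = s) = r (s v))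
      \<and> (AE \<omega> in cond_measure M (\<lambda>\<omega>. g \<omega> = s). \<forall>v\<in>V. Y v \<omega> = s v)"
    if s: "s \<in> S" "\<P>(\<omega> in M. g \<omega> = s) > 0" for s
  proof (intro conjI ballI)
    interpret N: prob_space "cond_measure M (\<lambda>\<omega>. g \<omega> = s)"
      by (rule prob_space_cond_measure) fact
    show "prob_space (cond_measure M (\<lambda>\<omega>. g \<omega> = s))" by (rule N.prob_space_axioms)
    have *: "N.indep_vars (\<lambda>_. label_space) Yt V \<and> (\<forall>v\<in>V. \<forall>l\<in>{0, 1}.
        \<P>(\<omega> in M. Yt v \<omega> = l \<bar> g \<omega> = s) = flip_matrix e ! s v ! l)"
      using noise s(2) unfolding noise_generated_by_def g_eq[OF s(1)] by blast
    then show "N.indep_vars (\<lambda>_. label_space) Yt V" ..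
    show "AE \<omega> in cond_measure M (\<lambda>\<omega>. g \<omega> = s). \<forall>v\<in>V. Y v \<omega> = s v"
      using AE_cond_measure[OF pred_g[OF s(1)]] by eventually_elim (simp add: g_eq[OF s(1)])
    fix v assume v: "v \<in> V"
    have "cond_expectation M (\<lambda>\<omega>. real (Yt v \<omega>)) (\<lambda>\<omega>. g \<omega> = s) = \<P>(\<omega> in M. Yt v \<omega> = 1 \<bar> g \<omega> = s)"
      unfolding cond_expectation_def using v Yt
      by (simp add: N.expectation_label prob_cond_measure[OF pred_label_eq[OF Yt[OF v]] pred_g[OF s(1)],
            unfolded space_cond_measure])
    also have "\<dots> = flip_matrix e ! s v ! 1" using * v by blast
    also have "\<dots> = r (s v)"
    proof -
      have "s v = 0 \<or> s v = 1" using s(1) v by (auto simp: S_def PiE_iff)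
      then show ?thesis by (auto simp: flip_matrix_def r_def)
    qed
    finally show "cond_expectation M (\<lambda>\<omega>. real (Yt v \<omega>)) (\<lambda>\<omega>. g \<omega> = s) = r (s v)" .
  qed
  show ?mean
    unfolding in_class
  proof (rule cond_expectation_eqI_finer[where g = g and h = "\<lambda>s. s i = k", OF finS gS pred_g _ _ _ pred_class pos_class])
    fix s assume s: "s \<in> S" "\<P>(\<omega> in M. g \<omega> = s) > 0"
    interpret N: prob_space "cond_measure M (\<lambda>\<omega>. g \<omega> = s)" using given[OF s] by blast
    have "cond_expectation M (\<lambda>\<omega>. r (Y u \<omega>)) (\<lambda>\<omega>. g \<omega> = s) = N.expectation (\<lambda>_. r (s u))"
      unfolding cond_expectation_def using given[OF s] u int_r[OF u]
      by (intro integral_cong_AE) auto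
    then show "cond_expectation M (\<lambda>\<omega>. real (Yt u \<omega>)) (\<lambda>\<omega>. g \<omega> = s)
        = cond_expectation M (\<lambda>\<omega>. r (Y u \<omega>)) (\<lambda>\<omega>. g \<omega> = s)"
      using given[OF s] u by (simp add: N.prob_space del: space_cond_measure)
  qed (use u in \<open>auto intro: integrable_label Yt int_r\<close>)
  show "?mult v" if v: "v \<in> V" "u \<noteq> v" for v
    unfolding in_class
  proof (rule cond_expectation_eqI_finer[where g = g and h = "\<lambda>s. s i = k", OF finS gS pred_g _ _ _ pred_class pos_class])
    fix s assume s: "s \<in> S" "\<P>(\<omega> in M. g \<omega> = s) > 0"
    interpret N: prob_space "cond_measure M (\<lambda>\<omega>. g \<omega> = s)" using given[OF s] by blast
    have "cond_expectation M (\<lambda>\<omega>. r (Y u \<omega>) * r (Y v \<omega>)) (\<lambda>\<omega>. g \<omega> = s) = N.expectation (\<lambda>_. r (s u) * r (s v))"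
      unfolding cond_expectation_def using given[OF s] u v int_r2[OF u v(1)]
      by (intro integral_cong_AE) auto
    also have "\<dots> = N.expectation (\<lambda>\<omega>. real (Yt u \<omega>)) * N.expectation (\<lambda>\<omega>. real (Yt v \<omega>))"
      using given[OF s] u v unfolding cond_expectation_def
      by (simp add: N.prob_space del: space_cond_measure)
    \<comment> \<open>The independence of the noise enters here, inside a single fibre.\<close>
    also have "\<dots> = cond_expectation M (\<lambda>\<omega>. real (Yt u \<omega>) * real (Yt v \<omega>)) (\<lambda>\<omega>. g \<omega> = s)"
      unfolding cond_expectation_def using given[OF s] u v
      by (intro N.indep_vars_label_mult[symmetric]) auto
    finally show "cond_expectation M (\<lambda>\<omega>. real (Yt u \<omega>) * real (Yt v \<omega>)) (\<lambda>\<omega>. g \<omega> = s)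
        = cond_expectation M (\<lambda>\<omega>. r (Y u \<omega>) * r (Y v \<omega>)) (\<lambda>\<omega>. g \<omega> = s)" by simp
  qed (use u v in \<open>auto intro: integrable_label_mult Yt int_r2\<close>)
qed

section \<open>Moments of the propagated label within one class\<close>

text \<open>The bias-variance split for a constant target \<open>a\<close>. It is applied within a
  class, where the true label is constant, and this is how the class-conditional means get into the
  final formula.\<close>

lemma (in prob_space) expectation_diff_square:
  fixes X :: "'a \<Rightarrow> real"
  assumes "integrable M X" "integrable M (\<lambda>\<omega>. (X \<omega>)\<^sup>2)"
  shows "expectation (\<lambda>\<omega>. (a - X \<omega>)\<^sup>2) = (expectation X - a)\<^sup>2 + variance X"
  using assms by (simp add: variance_eq power2_diff prob_space algebra_simps power2_eq_square[of "expectation X"])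

text \<open>The number \<open>s\<close> is the probability that a neighbour has clean label 1 given
  class \<open>k\<close>: agreement with \<open>i\<close> means label 1 if \<open>k = 1\<close> and
  label 0 if \<open>k = 0\<close>. Since \<open>r\<close> is affine, the noisy means are
  \<open>r k\<close> at the node and \<open>r s\<close> at each neighbour; \<open>r\<close> takes a
  real argument here so that it can be applied to \<open>s\<close>.\<close>

lemma (in prob_space) class_conditional_moments:
  fixes G :: "'v pair_pre_digraph"
  assumes graph: "pair_graph G"
    and Y: "\<And>v. v \<in> pverts G \<Longrightarrow> Y v \<in> M \<rightarrow>\<^sub>M label_space"
    and Yt: "\<And>v. v \<in> pverts G \<Longrightarrow> Yt v \<in> M \<rightarrow>\<^sub>M label_space"
    and noise: "noise_generated_by (flip_matrix e) M (pverts G) Y Yt"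
    and node: "i \<in> pverts G"
    and degree: "card (neighbors G i) = d" "d > 0"
    and k: "k \<in> {0, 1}" "\<P>(\<omega> in M. Y i \<omega> = k) > 0"
    and same_label: "\<And>j. j \<in> neighbors G i \<Longrightarrow> \<P>(\<omega> in M. Y i \<omega> = Y j \<omega> \<bar> Y i \<omega> = k) = p"
    and neighbors_indep: "prob_space.indep_vars (cond_measure M (\<lambda>\<omega>. Y i \<omega> = k)) (\<lambda>_. label_space) Y (neighbors G i)"
  defines "r \<equiv> \<lambda>y::real. e + (1 - 2 * e) * y"
    and "s \<equiv> if k = 1 then p else 1 - p"
    and "Q \<equiv> \<lambda>\<omega>. Y i \<omega> = k"
  shows cond_expectation_propagate:
      "cond_expectation M (propagate G \<alpha> d Yt i) Q = (1 - \<alpha>) * r k + \<alpha> * r s" (is ?mean)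
    and cond_variance_propagate:
      "cond_variance M (propagate G \<alpha> d Yt i) Q
        = (1 - \<alpha>)\<^sup>2 * (r k * (1 - r k)) + \<alpha>\<^sup>2 / d * (r s * (1 - r s))" (is ?var)
    and cond_expectation_diff_square_propagate:
      "cond_expectation M (\<lambda>\<omega>. (a - propagate G \<alpha> d Yt i \<omega>)\<^sup>2) Q
        = (cond_expectation M (propagate G \<alpha> d Yt i) Q - a)\<^sup>2 + cond_variance M (propagate G \<alpha> d Yt i) Q" (is ?square)
proof -
  interpret G: pair_graph G by fact
  interpret N: prob_space "cond_measure M Q"
    unfolding Q_def by (rule prob_space_cond_measure) fact
  \<comment> \<open>Propagation becomes one weighted sum over the node and its neighbours. The
    weights \<open>c\<close> are consistent because the graph has no loops, so \<open>i\<close> is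
    not its own neighbour.\<close>
  define J where "J = insert i (neighbors G i)"
  define c where "c = (\<lambda>v. if v = i then 1 - \<alpha> else \<alpha> / d)"
  define X where "X = propagate G \<alpha> d Yt i"
  define m where "m = (\<lambda>v. N.expectation (\<lambda>\<omega>. real (Yt v \<omega>)))"
  note fin = G.pair_finite_verts
  have nb: "neighbors G i \<subseteq> pverts G" "i \<notin> neighbors G i"
    unfolding neighbors_def using G.arc_snd_in_verts G.pair_no_loops by force+
  have fin_nb: "finite (neighbors G i)" using finite_subset[OF nb(1) fin] .
  have J: "finite J" "\<And>v. v \<in> J \<Longrightarrow> v \<in> pverts G"
    using fin_nb nb node by (auto simp: J_def)
  have YN: "Y v \<in> cond_measure M Q \<rightarrow>\<^sub>M label_space" if "v \<in> pverts G" for v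
    using Y[OF that] by simp
  have YtN: "Yt v \<in> cond_measure M Q \<rightarrow>\<^sub>M label_space" if "v \<in> J" for v
    using Yt[OF J(2)[OF that]] by simp
  have AE_Q: "AE \<omega> in cond_measure M Q. Y i \<omega> = k"
    unfolding Q_def by (rule AE_cond_measure[OF pred_label_eq[OF Y[OF node]]])
  have int_r: "integrable (cond_measure M Q) (\<lambda>\<omega>. r (Y v \<omega>))" if "v \<in> pverts G" for v
    unfolding r_def using N.integrable_label[OF YN[OF that]] by simp

  have m_r: "m v = N.expectation (\<lambda>\<omega>. r (Y v \<omega>))" if "v \<in> J" for v
    using cond_expectation_noisy_label[OF fin Y Yt noise node k(2) J(2)[OF that]]
    unfolding cond_expectation_def m_def r_def Q_def .
  have m_i: "m i = r k"
  proof -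
    have "N.expectation (\<lambda>\<omega>. r (Y i \<omega>)) = N.expectation (\<lambda>_. r k)"
      using AE_Q int_r[OF node] by (intro integral_cong_AE) auto
    then show ?thesis using m_r[of i] by (simp add: J_def N.prob_space del: space_cond_measure)
  qed
  have m_nb: "m j = r s" if j: "j \<in> neighbors G i" for j
  proof -
    have jV: "j \<in> pverts G" using j nb by auto
    have [measurable]: "Y i \<in> M \<rightarrow>\<^sub>M label_space" "Y j \<in> M \<rightarrow>\<^sub>M label_space"
      using Y node jV by auto
    have [measurable]: "Measurable.pred M (\<lambda>\<omega>. Y i \<omega> = k)" "Measurable.pred M (\<lambda>\<omega>. Y j \<omega> = k)"
      by (rule pred_label_eq; fact)+
    have same: "\<P>(\<omega> in cond_measure M Q. Y j \<omega> = k) = p"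
    proof -
      \<comment> \<open>Inside the event \<open>Y i = k\<close>, having the same label as
        \<open>i\<close> is the same as having label \<open>k\<close>.\<close>
      have "\<P>(\<omega> in M. Y j \<omega> = k \<bar> Y i \<omega> = k) = \<P>(\<omega> in M. Y i \<omega> = Y j \<omega> \<bar> Y i \<omega> = k)"
        unfolding cond_prob_def by (intro arg_cong2[where f="(/)"] arg_cong[where f=prob]) auto
      then show ?thesis
        using same_label[OF j] prob_cond_measure[of "\<lambda>\<omega>. Y j \<omega> = k" Q] by (simp add: Q_def)
    qed
    have "\<P>(\<omega> in cond_measure M Q. Y j \<omega> = 1) = s"
    proof (cases "k = 1")
      case True
      then show ?thesis using same by (simp add: s_def)
    next
      case False
      then have k0: "k = 0" using k by simp
      \<comment> \<open>For class 0 the hypothesis gives the probability of label 0, so the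
        probability of label 1 comes from the complement, the labels being binary.\<close>
      have "{\<omega> \<in> space M. Y j \<omega> = 1} = space (cond_measure M Q) - {\<omega> \<in> space M. Y j \<omega> = 0}"
        using label_valued[OF Y[OF jV]] by force
      moreover have "{\<omega> \<in> space M. Y j \<omega> = 0} \<in> N.events"
        using \<open>Measurable.pred M (\<lambda>\<omega>. Y j \<omega> = k)\<close> k0 by (simp add: cond_measure_def pred_def)
      ultimately show ?thesis
        using N.prob_compl[of "{\<omega> \<in> space M. Y j \<omega> = 0}"] same k0 by (simp add: s_def)
    qed
    then have "N.expectation (\<lambda>\<omega>. real (Y j \<omega>)) = s"
      using N.expectation_label[OF YN[OF jV]] by simp
    then have "N.expectation (\<lambda>\<omega>. r (Y j \<omega>)) = r s"
      unfolding r_def using N.integrable_label[OF YN[OF jV]]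
      by (simp add: N.prob_space del: space_cond_measure)
    then show ?thesis using m_r[of j] j by (simp add: J_def)
  qed

  have mixed: "N.expectation (\<lambda>\<omega>. real (Yt u \<omega>) * real (Yt v \<omega>)) = N.expectation (\<lambda>\<omega>. r (Y u \<omega>) * r (Y v \<omega>))"
    if "u \<in> J" "v \<in> J" "u \<noteq> v" for u v
    using cond_expectation_noisy_label_mult[OF fin Y Yt noise node k(2) J(2)[OF that(1)] J(2)[OF that(2)] that(3)]
    unfolding cond_expectation_def r_def Q_def .
  \<comment> \<open>Within the class the label of \<open>i\<close> is almost surely the constant
    \<open>k\<close>, so its factor leaves the expectation whatever \<open>Y v\<close> is.\<close>
  have uncor_i: "N.expectation (\<lambda>\<omega>. r (Y i \<omega>) * r (Y v \<omega>)) = m i * m v" if v: "v \<in> J" for v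
  proof -
    have "N.expectation (\<lambda>\<omega>. r (Y i \<omega>) * r (Y v \<omega>)) = N.expectation (\<lambda>\<omega>. r k * r (Y v \<omega>))"
      using AE_Q borel_measurable_integrable[OF int_r[OF node]] borel_measurable_integrable[OF int_r[OF J(2)[OF v]]]
      by (intro integral_cong_AE) (auto intro!: borel_measurable_times)
    then show ?thesis by (simp add: m_i m_r[OF v])
  qed
  \<comment> \<open>For two neighbours the factorisation comes from the conditional independence of
    their clean labels; expanding the product of the two affine images reduces it to the labels
    themselves.\<close>
  have uncor_nb: "N.expectation (\<lambda>\<omega>. r (Y u \<omega>) * r (Y v \<omega>)) = m u * m v"
    if uv: "u \<in> neighbors G i" "v \<in> neighbors G i" "u \<noteq> v" for u v
  proof -
    have V: "u \<in> pverts G" "v \<in> pverts G" "u \<in> J" "v \<in> J" using uv nb by (auto simp: J_def)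
    note int = N.integrable_label[OF YN[OF V(1)]] N.integrable_label[OF YN[OF V(2)]]
      N.integrable_label_mult[OF YN[OF V(1)] YN[OF V(2)]]
    have "N.expectation (\<lambda>\<omega>. r (Y u \<omega>) * r (Y v \<omega>))
        = N.expectation (\<lambda>\<omega>. e * e + e * (1 - 2 * e) * real (Y u \<omega>) + e * (1 - 2 * e) * real (Y v \<omega>)
            + (1 - 2 * e)\<^sup>2 * (real (Y u \<omega>) * real (Y v \<omega>)))"
      by (intro Bochner_Integration.integral_cong) (auto simp: r_def algebra_simps power2_eq_square)
    also have "\<dots> = r (N.expectation (\<lambda>\<omega>. real (Y u \<omega>))) * r (N.expectation (\<lambda>\<omega>. real (Y v \<omega>)))"
      using int N.indep_vars_label_mult[OF neighbors_indep[folded Q_def] uv]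
      by (simp add: N.prob_space del: space_cond_measure)
         (simp add: r_def algebra_simps power2_eq_square)
    also have "\<dots> = m u * m v"
      unfolding m_r[OF V(3)] m_r[OF V(4)] r_def using int
      by (simp add: N.prob_space del: space_cond_measure)
    finally show ?thesis .
  qed
  have uncor: "N.expectation (\<lambda>\<omega>. real (Yt u \<omega>) * real (Yt v \<omega>)) = m u * m v"
    if uv: "u \<in> J" "v \<in> J" "u \<noteq> v" for u v
  proof -
    consider "u = i" | "v = i" | "u \<in> neighbors G i" "v \<in> neighbors G i"
      using uv by (auto simp: J_def)
    then show ?thesis
    proof cases
      case 1
      then show ?thesis using mixed[OF uv] uncor_i[OF uv(2)] by simp
    next
      case 2
      then show ?thesis using mixed[OF uv] uncor_i[OF uv(1)] by (simp add: mult.commute)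
    next
      case 3
      then show ?thesis using mixed[OF uv] uncor_nb uv by simp
    qed
  qed

  have X: "X = (\<lambda>\<omega>. \<Sum>v\<in>J. c v * real (Yt v \<omega>))"
  proof
    fix \<omega>
    have "(\<Sum>v\<in>neighbors G i. c v * real (Yt v \<omega>)) = \<alpha> / d * (\<Sum>v\<in>neighbors G i. real (Yt v \<omega>))"
      unfolding sum_distrib_left using nb by (intro sum.cong) (auto simp: c_def)
    then show "X \<omega> = (\<Sum>v\<in>J. c v * real (Yt v \<omega>))"
      using fin_nb nb by (simp add: X_def J_def propagate_def c_def)
  qed
  \<comment> \<open>All neighbours contribute equally. The factor \<open>d\<close> cancels the
    \<open>d\<close> in \<alpha> / \<open>d\<close> for the mean, and one of its two copies in the
    square of \<alpha> / \<open>d\<close> for the variance.\<close>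
  have sum_J: "(\<Sum>v\<in>J. f v) = f i + d * b" if "\<And>v. v \<in> neighbors G i \<Longrightarrow> f v = b" for f :: "'v \<Rightarrow> real" and b :: real
    using that fin_nb nb degree by (simp add: J_def)
  have "N.expectation X = (\<Sum>v\<in>J. c v * m v)"
    unfolding X m_def by (rule N.expectation_weighted_label_sum) (use J YtN uncor in \<open>auto simp: m_def\<close>)
  also have "\<dots> = c i * m i + d * (\<alpha> / d * r s)"
    using nb by (subst sum_J[of _ "\<alpha> / d * r s"]) (auto simp: c_def m_nb)
  also have "\<dots> = (1 - \<alpha>) * r k + \<alpha> * r s"
    using degree by (simp add: m_i c_def)
  finally show ?mean unfolding cond_expectation_def X_def .
  have "N.variance X = (\<Sum>v\<in>J. (c v)\<^sup>2 * (m v * (1 - m v)))"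
    unfolding X m_def by (rule N.variance_weighted_label_sum) (use J YtN uncor in \<open>auto simp: m_def\<close>)
  also have "\<dots> = (c i)\<^sup>2 * (m i * (1 - m i)) + d * ((\<alpha> / d)\<^sup>2 * (r s * (1 - r s)))"
    using nb by (subst sum_J[of _ "(\<alpha> / d)\<^sup>2 * (r s * (1 - r s))"]) (auto simp: c_def m_nb)
  also have "\<dots> = (1 - \<alpha>)\<^sup>2 * (r k * (1 - r k)) + \<alpha>\<^sup>2 / d * (r s * (1 - r s))"
    using degree by (simp add: m_i c_def power2_eq_square)
  finally show ?var unfolding cond_variance_def cond_expectation_def X_def .
  have "integrable (cond_measure M Q) X"
    unfolding X using N.integrable_label[OF YtN] by simp
  moreover have "integrable (cond_measure M Q) (\<lambda>\<omega>. (X \<omega>)\<^sup>2)"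
  \<comment> \<open>The square is a finite double sum of products of two labels, each of them
    bounded.\<close>
  proof -
    have "(\<lambda>\<omega>. (X \<omega>)\<^sup>2) = (\<lambda>\<omega>. \<Sum>u\<in>J. \<Sum>v\<in>J. (c u * c v) * (real (Yt u \<omega>) * real (Yt v \<omega>)))"
      by (simp add: X power2_eq_square sum_product mult_ac)
    then show ?thesis
      using N.integrable_label_mult[OF YtN YtN]
      by (simp only:) (intro Bochner_Integration.integrable_sum integrable_mult_right)
  qed
  ultimately show ?square
    unfolding cond_variance_def cond_expectation_def X_def[symmetric] by (rule N.expectation_diff_square)
qed

section \<open>Averaging over the two classes\<close>

theorem theorem1:
  fixes M :: "'a measure" and G :: "'v pair_pre_digraph"
    and Y Yt :: "'v \<Rightarrow> 'a \<Rightarrow> nat" and Yh :: "'v \<Rightarrow> 'a \<Rightarrow> real"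
    and e p \<alpha> :: real and d :: nat and i :: 'v
  assumes "prob_space M"
    and "pair_graph G"
    and "\<And>v. v \<in> pverts G \<Longrightarrow> Y v \<in> M \<rightarrow>\<^sub>M label_space"
    and "\<And>v. v \<in> pverts G \<Longrightarrow> Yt v \<in> M \<rightarrow>\<^sub>M label_space"
    and noise: "noise_generated_by (flip_matrix e) M (pverts G) Y Yt"
    and node: "i \<in> pverts G"
    and propagation: "\<And>\<omega>. \<omega> \<in> space M \<Longrightarrow> Yh i \<omega> = propagate G \<alpha> d Yt i \<omega>"
    and degree: "card (neighbors G i) = d" "d > 0"
    and same_label: "\<And>k j. k \<in> {0, 1} \<Longrightarrow> \<P>(\<omega> in M. Y i \<omega> = k) > 0 \<Longrightarrow> j \<in> neighbors G i \<Longrightarrow>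
          \<P>(\<omega> in M. Y i \<omega> = Y j \<omega> \<bar> Y i \<omega> = k) = p"
    and neighbors_indep: "\<And>k. k \<in> {0, 1} \<Longrightarrow> \<P>(\<omega> in M. Y i \<omega> = k) > 0 \<Longrightarrow>
          prob_space.indep_vars (cond_measure M (\<lambda>\<omega>. Y i \<omega> = k)) (\<lambda>_. label_space) Y (neighbors G i)"
  shows
    "(LINT \<omega>|M. (real (Y i \<omega>) - Yh i \<omega>)\<^sup>2) =
         \<P>(\<omega> in M. Y i \<omega> = 0) * (cond_expectation M (Yh i) (\<lambda>\<omega>. Y i \<omega> = 0))\<^sup>2
       + \<P>(\<omega> in M. Y i \<omega> = 1) * (cond_expectation M (Yh i) (\<lambda>\<omega>. Y i \<omega> = 1) - 1)\<^sup>2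
       + mean_cond_variance M (Yh i) (Y i)
     \<and> (\<P>(\<omega> in M. Y i \<omega> = 0) > 0 \<longrightarrow>
         cond_expectation M (Yh i) (\<lambda>\<omega>. Y i \<omega> = 0)
           = (1 - \<alpha>) * e + \<alpha> * (p * e + (1 - p) * (1 - e)))
     \<and> (\<P>(\<omega> in M. Y i \<omega> = 1) > 0 \<longrightarrow>
         cond_expectation M (Yh i) (\<lambda>\<omega>. Y i \<omega> = 1)
           = (1 - \<alpha>) * (1 - e) + \<alpha> * (p * (1 - e) + (1 - p) * e))
     \<and> mean_cond_variance M (Yh i) (Y i)
           = (1 - \<alpha>)\<^sup>2 * e * (1 - e)
             + \<alpha>\<^sup>2 / real d * (p * e + (1 - p) * (1 - e)) * (1 - p * e - (1 - p) * (1 - e))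
     \<and> (\<forall>k\<in>{0, 1}. \<P>(\<omega> in M. Y i \<omega> = k) > 0 \<longrightarrow>
         cond_variance M (Yh i) (\<lambda>\<omega>. Y i \<omega> = k)
           = (1 - \<alpha>)\<^sup>2 * e * (1 - e)
             + \<alpha>\<^sup>2 / real d * (p * e + (1 - p) * (1 - e)) * (1 - p * e - (1 - p) * (1 - e)))"
proof -
  interpret prob_space M by fact
  interpret G: pair_graph G by fact
  note Y = assms(3) and Yt = assms(4)
  define X where "X = propagate G \<alpha> d Yt i"
  define Q where "Q = (\<lambda>k \<omega>. Y i \<omega> = k)"
  define P where "P = (\<lambda>k. \<P>(\<omega> in M. Y i \<omega> = k))"
  \<comment> \<open>The mean noisy label of a neighbour given class 0; given class 1 it is 1 -
    \<open>q\<close>. The variance \<open>W\<close> is therefore common to both classes.\<close>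
  define q where "q = p * e + (1 - p) * (1 - e)"
  define W where "W = (1 - \<alpha>)\<^sup>2 * e * (1 - e) + \<alpha>\<^sup>2 / real d * q * (1 - q)"
  have W: "(1 - \<alpha>)\<^sup>2 * e * (1 - e)
      + \<alpha>\<^sup>2 / real d * (p * e + (1 - p) * (1 - e)) * (1 - p * e - (1 - p) * (1 - e)) = W"
    by (simp add: W_def q_def algebra_simps)
  have Yh_X: "cond_expectation M (Yh i) R = cond_expectation M X R" for R
    unfolding cond_expectation_def X_def
    by (intro Bochner_Integration.integral_cong) (simp_all add: propagation)
  have Yh_X_var: "cond_variance M (Yh i) R = cond_variance M X R" for R
    unfolding cond_variance_def Yh_X unfolding X_def
    by (intro Bochner_Integration.integral_cong) (simp_all add: propagation)

  have P_pos: "P k > 0" if "P k \<noteq> 0" for k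
    using that by (simp add: P_def zero_less_measure_iff)
  have moments:
    "cond_expectation M X (Q k) = (if k = 1 then (1 - \<alpha>) * (1 - e) + \<alpha> * (1 - q) else (1 - \<alpha>) * e + \<alpha> * q)"
    "cond_variance M X (Q k) = W"
    "cond_expectation M (\<lambda>\<omega>. (a - X \<omega>)\<^sup>2) (Q k) = (cond_expectation M X (Q k) - a)\<^sup>2 + W"
    if k: "k \<in> {0, 1}" "P k > 0" for k a
  proof -
    note * = assms(2) Y Yt noise node degree k(1) k(2)[unfolded P_def] same_label[OF k[unfolded P_def]]
      neighbors_indep[OF k[unfolded P_def]]
    have r: "e + (1 - 2 * e) * real k = (if k = 1 then 1 - e else e)"
      "e + (1 - 2 * e) * (if k = 1 then p else 1 - p) = (if k = 1 then 1 - q else q)"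
      using k(1) by (auto simp: q_def algebra_simps)
    show "cond_expectation M X (Q k)
        = (if k = 1 then (1 - \<alpha>) * (1 - e) + \<alpha> * (1 - q) else (1 - \<alpha>) * e + \<alpha> * q)"
      unfolding X_def Q_def using cond_expectation_propagate[OF *, of \<alpha>] unfolding r by simp
    show var: "cond_variance M X (Q k) = W"
      unfolding X_def Q_def using cond_variance_propagate[OF *, of \<alpha>] unfolding r by (simp add: W_def mult_ac split: if_splits)
    show "cond_expectation M (\<lambda>\<omega>. (a - X \<omega>)\<^sup>2) (Q k) = (cond_expectation M X (Q k) - a)\<^sup>2 + W"
      using cond_expectation_diff_square_propagate[OF *, of a \<alpha>] var by (simp add: X_def Q_def)
  qed

  have Yi: "Y i \<in> M \<rightarrow>\<^sub>M label_space" using Y[OF node] .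
  have pred_Q: "Measurable.pred M (Q k)" for k unfolding Q_def by (rule pred_label_eq[OF Yi])
  have Y_range: "Y i \<in> space M \<rightarrow> {0, 1}" using label_valued[OF Yi] by auto
  have total: "P 0 + P 1 = 1"
  proof -
    have "P 0 + P 1 = prob ({\<omega> \<in> space M. Y i \<omega> = 0} \<union> {\<omega> \<in> space M. Y i \<omega> = 1})"
      unfolding P_def using pred_Q by (intro finite_measure_Union[symmetric]) (auto simp: Q_def pred_def)
    also have "\<dots> = prob (space M)"
      using Y_range by (intro arg_cong[where f=prob]) auto
    finally show ?thesis by (simp add: prob_space)
  qed
  \<comment> \<open>The value \<open>W\<close> is available only for a class of positive
    probability; the factor \<open>P k\<close> makes the equation true for a null class too.\<close>
  have var_term: "P k * cond_variance M X (Q k) = P k * W" if "k \<in> {0, 1}" for k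
    using moments(2)[OF that] P_pos by (cases "P k = 0") auto
  have mean_var: "mean_cond_variance M (Yh i) (Y i) = W"
  proof -
    have "mean_cond_variance M (Yh i) (Y i) = P 0 * cond_variance M X (Q 0) + P 1 * cond_variance M X (Q 1)"
      unfolding mean_cond_variance_def Yh_X_var P_def Q_def by simp
    also have "\<dots> = (P 0 + P 1) * W" by (simp only: var_term insert_iff simp_thms distrib_right)
    finally show ?thesis using total by simp
  qed

  have nb: "neighbors G i \<subseteq> pverts G"
    unfolding neighbors_def using G.arc_snd_in_verts by force
  have X_meas: "X \<in> borel_measurable M"
    unfolding X_def propagate_def
    by (intro borel_measurable_add borel_measurable_times borel_measurable_const borel_measurable_sum
          borel_measurable_label) (use Yt node nb in auto)
  \<comment> \<open>The weights may have either sign, hence the absolute values. Boundedness of the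
    propagated label supplies the integrability of the squared error that the split into classes
    requires.\<close>
  have X_bound: "\<bar>X \<omega>\<bar> \<le> \<bar>1 - \<alpha>\<bar> + \<bar>\<alpha> / d\<bar> * d" if \<omega>: "\<omega> \<in> space M" for \<omega>
  proof -
    have le1: "real (Yt v \<omega>) \<le> 1" if "v \<in> pverts G" for v
      using label_valued[OF Yt[OF that] \<omega>] by auto
    have "(\<Sum>j\<in>neighbors G i. real (Yt j \<omega>)) \<le> (\<Sum>j\<in>neighbors G i. 1)"
      using nb le1 by (intro sum_mono) auto
    then have "\<bar>\<Sum>j\<in>neighbors G i. real (Yt j \<omega>)\<bar> \<le> d"
      using degree by (simp add: sum_nonneg)
    then have "\<bar>\<alpha> / d * (\<Sum>j\<in>neighbors G i. real (Yt j \<omega>))\<bar> \<le> \<bar>\<alpha> / d\<bar> * d"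
      unfolding abs_mult by (intro mult_left_mono) auto
    moreover have "\<bar>(1 - \<alpha>) * real (Yt i \<omega>)\<bar> \<le> \<bar>1 - \<alpha>\<bar>"
      unfolding abs_mult using le1[OF node] by (simp add: mult_left_le)
    ultimately show ?thesis unfolding X_def propagate_def by linarith
  qed
  define err where "err = (\<lambda>\<omega>. (real (Y i \<omega>) - X \<omega>)\<^sup>2)"
  have err_meas: "err \<in> borel_measurable M"
    unfolding err_def using borel_measurable_label[OF Yi] X_meas by measurable
  have err_int: "integrable M err"
  proof (rule integrable_const_bound[where B="(1 + (\<bar>1 - \<alpha>\<bar> + \<bar>\<alpha> / d\<bar> * d))\<^sup>2"], intro AE_I2)
    fix \<omega> assume "\<omega> \<in> space M"
    then have "\<bar>real (Y i \<omega>) - X \<omega>\<bar> \<le> 1 + (\<bar>1 - \<alpha>\<bar> + \<bar>\<alpha> / d\<bar> * d)"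
      using X_bound[of \<omega>] label_valued[OF Yi, of \<omega>] by auto
    then show "norm (err \<omega>) \<le> (1 + (\<bar>1 - \<alpha>\<bar> + \<bar>\<alpha> / d\<bar> * d))\<^sup>2"
      unfolding err_def by (simp add: abs_le_square_iff[symmetric])
  qed (rule err_meas)
  \<comment> \<open>Within class \<open>k\<close> the random target \<open>Y i\<close> is almost
    surely \<open>k\<close>, so the squared error has a constant target and the bias-variance split
    applies.\<close>
  have err_term: "P k * cond_expectation M err (Q k) = P k * ((cond_expectation M X (Q k) - k)\<^sup>2 + W)"
    if k: "k \<in> {0, 1}" for k
  proof (cases "P k = 0")
    case False
    have "AE \<omega> in cond_measure M (Q k). err \<omega> = (real k - X \<omega>)\<^sup>2"
      using AE_cond_measure[OF pred_Q[of k]] by eventually_elim (simp add: err_def Q_def)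
    then have "cond_expectation M err (Q k) = cond_expectation M (\<lambda>\<omega>. (real k - X \<omega>)\<^sup>2) (Q k)"
      unfolding cond_expectation_def using err_meas X_meas by (intro integral_cong_AE) auto
    then show ?thesis using moments(3)[OF k P_pos[OF False]] by simp
  qed simp
  have "expectation (\<lambda>\<omega>. (real (Y i \<omega>) - Yh i \<omega>)\<^sup>2) = expectation err"
    by (intro Bochner_Integration.integral_cong) (simp_all add: err_def X_def propagation)
  also have "\<dots> = P 0 * cond_expectation M err (Q 0) + P 1 * cond_expectation M err (Q 1)"
    using expectation_eq_sum_cond_expectation[OF _ Y_range pred_Q[unfolded Q_def] err_int]
    by (simp add: P_def Q_def)
  also have "\<dots> = P 0 * ((cond_expectation M X (Q 0) - 0)\<^sup>2 + W) + P 1 * ((cond_expectation M X (Q 1) - 1)\<^sup>2 + W)"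
    using err_term[of 0] err_term[of 1] by auto
  \<comment> \<open>Both classes contribute the same \<open>W\<close>, so it is collected with total
    weight \<open>P 0 + P 1\<close>, which is 1.\<close>
  also have "\<dots> = P 0 * (cond_expectation M X (Q 0))\<^sup>2 + P 1 * (cond_expectation M X (Q 1) - 1)\<^sup>2 + (P 0 + P 1) * W"
    by (simp add: algebra_simps)
  finally have decomposition: "expectation (\<lambda>\<omega>. (real (Y i \<omega>) - Yh i \<omega>)\<^sup>2)
      = P 0 * (cond_expectation M X (Q 0))\<^sup>2 + P 1 * (cond_expectation M X (Q 1) - 1)\<^sup>2 + W"
    using total by simp
  have q': "p * (1 - e) + (1 - p) * e = 1 - q" by (simp add: q_def algebra_simps)
  show ?thesis
    unfolding W mean_var Yh_X Yh_X_var q' unfolding q_def[symmetric]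
    using decomposition moments(1)[of 0] moments(1)[of 1] moments(2) unfolding P_def Q_def by simp
qed

end
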